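(* Let $n,d,T\ge1$ be integers and let $p,q\in[1,\infty]$ be Hölder conjugates. Let $f_1,\dots,f_n:\mathbb{R}^d\to\mathbb{R}$ be continuously differentiable and let $L_q>0$ be such that $\|\nabla f_i(x)-\nabla f_i(y)\|_p\le L_q\|x-y\|_q$ for all $i\in\{1,\dots,n\}$ and $x,y\in\mathbb{R}^d$. Let $f=\frac1n\sum_{i=1}^nf_i$ and assume that $f$ is convex and admits a global minimizer $x_*$; write $f_*=f(x_* )$. Then for all $D,\gamma>0$ and every $x_1\in\mathbb{R}^d$, the iterates of SignSVRG, Variant 1 (see context), run with parameters $L_q,D,\gamma$, satisfy $$\frac1T\sum_{t=1}^T\mathbb{E}\left[\frac{f(x_t)-f_*}{2L_qD+\sqrt{2L_q(f(x_t)-f_* )}}\right]\le\frac{\|x_1-x_*\|^2}{2T\gamma}+\frac{\gamma d}{2}.$$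
   Context: $\|\cdot\|$ is the Euclidean norm, $\|\cdot\|_r$ the $\ell_r$-norm on $\mathbb{R}^d$; $\mathrm{sign}$ acts coordinate-wise with $\mathrm{sign}(0)=0$. SignSVRG algorithm, Variant 1. Input: deterministic $x_1\in\mathbb{R}^d$, $L_q,D,\gamma>0$. Set $k(1)=1$, $\tilde x_1=x_1$ (initial reference point), $g_1=\nabla f(x_1)$. For $t=1,\dots,T$: 1. Sample $i_t$ uniformly on $\{1,\dots,n\}$ and $U_t$ uniformly on $[-1,1]^d$, independent of each other and of the past. 2. Set the scalar $G_t=L_q\|x_t-\tilde x_{k(t)}\|_q+\|g_{k(t)}\|_p$. 3. Set $x_t^+=x_t-\gamma\,\mathrm{sign}\big(\nabla f_{i_t}(x_t)-\nabla f_{i_t}(\tilde x_{k(t)})+g_{k(t)}+G_tU_t\big)$ and $x_{t+1}=x_t^+$. 4. If $\|x_t^+-\tilde x_{k(t)}\|_q\le D$, keep the reference point: $k(t+1)=k(t)$. Otherwise update it: $k(t+1)=k(t)+1$, $\tilde x_{k(t+1)}=x_t^+$, $g_{k(t+1)}=\nabla f(x_t^+)$. *)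

theory Defs
  imports "HOL-Probability.Probability"
begin

definition lnorm :: "ennreal \<Rightarrow> real ^ 'd \<Rightarrow> real" where
  "lnorm r x = (if r = \<infinity> then Max (range (\<lambda>j. \<bar>x $ j\<bar>))
     else (\<Sum>j\<in>UNIV. \<bar>x $ j\<bar> powr enn2real r) powr (1 / enn2real r))"

text \<open>On vectors the library constant \<^const>\<open>sgn\<close> is normalisation by the Euclidean norm,
  not the coordinatewise sign.\<close>

definition sign_vec :: "real ^ 'd \<Rightarrow> real ^ 'd" where
  "sign_vec x = (\<chi> j. sgn (x $ j))"

definition grad :: "('a::real_inner \<Rightarrow> real) \<Rightarrow> 'a \<Rightarrow> 'a" where
  "grad f x = (THE D. GDERIV f x :> D)"

lemma grad_eqI:
  assumes "GDERIV f x :> D"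
  shows "grad f x = D"
proof -
  have "E = D" if "GDERIV f x :> E" for E
  proof -
    have "inner E = inner D" (is "?a = ?b")
      using that assms has_derivative_unique unfolding gderiv_def
      by (metis (no_types, lifting) ext inner_commute)
    hence "inner (E - D) (E - D) = 0"
      by (metis cancel_comm_monoid_add_class.diff_cancel inner_diff_left)
    thus ?thesis by simp
  qed
  thus ?thesis unfolding grad_def using assms by blast
qed

definition continuously_differentiable :: "(real ^ 'd \<Rightarrow> real) \<Rightarrow> bool" where
  "continuously_differentiable f \<longleftrightarrow>
     (\<forall>x. f differentiable (at x)) \<and> continuous_on UNIV (grad f)"

definition average :: "nat \<Rightarrow> (nat \<Rightarrow> 'a \<Rightarrow> real) \<Rightarrow> 'a \<Rightarrow> real" where
  "average n f x = (1 / real n) * (\<Sum>i = 1..n. f i x)"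

text \<open>In round \<open>t\<close> the fields hold \<open>x\<^sub>t\<close>, the epoch counter \<open>k(t)\<close>, and the reference
  point and reference gradient with index \<open>k(t)\<close>; earlier reference data are never read again.\<close>

record ('d::finite) svrg_state =
  iterate :: "real ^ 'd"
  epoch :: nat
  ref_point :: "real ^ 'd"
  ref_grad :: "real ^ 'd"

definition svrg_init :: "nat \<Rightarrow> (nat \<Rightarrow> real ^ 'd \<Rightarrow> real) \<Rightarrow> real ^ 'd \<Rightarrow> 'd svrg_state" where
  "svrg_init n f x1 = \<lparr>iterate = x1, epoch = 1, ref_point = x1, ref_grad = grad (average n f) x1\<rparr>"

definition svrg_step ::
  "nat \<Rightarrow> (nat \<Rightarrow> real ^ 'd \<Rightarrow> real) \<Rightarrow> ennreal \<Rightarrow> ennreal \<Rightarrow> real \<Rightarrow> real \<Rightarrow> real \<Rightarrow>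
   nat \<Rightarrow> real ^ 'd \<Rightarrow> 'd svrg_state \<Rightarrow> 'd svrg_state" where
  "svrg_step n f p q L D \<gamma> i u s =
    (let x = iterate s; y = ref_point s; g = ref_grad s;
         G = L * lnorm q (x - y) + lnorm p g;
         x' = x - \<gamma> *\<^sub>R sign_vec (grad (f i) x - grad (f i) y + g + G *\<^sub>R u)
     in if lnorm q (x' - y) \<le> D
        then s\<lparr>iterate := x'\<rparr>
        else \<lparr>iterate = x', epoch = epoch s + 1, ref_point = x',
               ref_grad = grad (average n f) x'\<rparr>)"

text \<open>Rounds are numbered from 1; the value at index 0 is a dummy.  The sequences \<open>i\<close> and \<open>u\<close>
  are one realisation of the sampled indices and dithering vectors.\<close>

fun sign_svrg ::
  "nat \<Rightarrow> (nat \<Rightarrow> real ^ 'd \<Rightarrow> real) \<Rightarrow> ennreal \<Rightarrow> ennreal \<Rightarrow> real \<Rightarrow> real \<Rightarrow> real \<Rightarrow> real ^ 'd \<Rightarrow>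
   (nat \<Rightarrow> nat) \<Rightarrow> (nat \<Rightarrow> real ^ 'd) \<Rightarrow> nat \<Rightarrow> 'd svrg_state" where
  "sign_svrg n f p q L D \<gamma> x1 i u 0 = svrg_init n f x1"
| "sign_svrg n f p q L D \<gamma> x1 i u (Suc 0) = svrg_init n f x1"
| "sign_svrg n f p q L D \<gamma> x1 i u (Suc (Suc t)) =
     svrg_step n f p q L D \<gamma> (i (Suc t)) (u (Suc t)) (sign_svrg n f p q L D \<gamma> x1 i u (Suc t))"

text \<open>Each \<open>I t\<close> is uniform on \<open>{1..n}\<close>, each \<open>U t\<close> is uniform on the cube, and all of
  \<open>I 1, U 1, \<dots>, I T, U T\<close> are mutually independent: the pairs are independent across rounds,
  and within each pair the two components are independent (spelled out by preimages because
  \<open>indep_var\<close> needs both variables to have the same type).\<close>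

definition svrg_sampling ::
  "'w measure \<Rightarrow> nat \<Rightarrow> nat \<Rightarrow> (nat \<Rightarrow> 'w \<Rightarrow> nat) \<Rightarrow> (nat \<Rightarrow> 'w \<Rightarrow> real ^ 'd) \<Rightarrow> bool" where
  "svrg_sampling M n T I U \<longleftrightarrow>
     prob_space M \<and>
     (\<forall>t\<in>{1..T}.
        I t \<in> M \<rightarrow>\<^sub>M count_space {1..n} \<and>
        distr M (count_space {1..n}) (I t) = uniform_count_measure {1..n} \<and>
        U t \<in> M \<rightarrow>\<^sub>M borel \<and>
        distr M borel (U t) = uniform_measure lborel {v. \<forall>j. v $ j \<in> {-1..1}} \<and>
        prob_space.indep_set M {I t -` A \<inter> space M |A. A \<in> sets (count_space {1..n})}
                               {U t -` B \<inter> space M |B. B \<in> sets borel}) \<and>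
     prob_space.indep_vars M (\<lambda>_. count_space {1..n} \<Otimes>\<^sub>M borel) (\<lambda>t \<omega>. (I t \<omega>, U t \<omega>)) {1..T}"

end

theory Submission
  imports Defs
begin

text \<open>Given the past, the dithered sign of a vector \<open>v\<close> with all entries bounded by \<open>G\<close> has
  expectation \<open>v / G\<close>, so the expected step is \<open>\<gamma> \<nabla>f(x) / G\<close> and the squared distance to the
  minimizer drops in expectation by at least \<open>2 \<gamma> (f(x) - f\<^sub>*) / G - \<gamma>\<^sup>2 d\<close>.  Because the reference
  point stays within \<open>D\<close>, smoothness and the bound \<open>\<parallel>\<nabla>f(x)\<parallel>\<^sub>p\<^sup>2 \<le> 2 L (f(x) - f\<^sub>*)\<close> show that \<open>G\<close> is at
  most the denominator of the claim; the distances then telescope.\<close>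

subsection \<open>The norms of conjugate exponents\<close>

text \<open>Three points shape the details. The dither amplitude \<open>G\<close> may vanish; then
  \<open>v = 0\<close> as well, and the convention \<open>a / 0 = 0\<close> keeps the expectation
  formula valid without exception, so the degenerate case returns only when the gap is compared with
  the expected step. Conditioning on the past is carried out by Fubini's theorem: the state before a
  round is a function of the earlier noise, so its joint law with the current noise is a
  product.\<close>

lemma lnorm_top: "lnorm \<top> x = Max (range (\<lambda>j. \<bar>x $ j\<bar>))"
  by (simp add: lnorm_def flip: infinity_ennreal_def)

lemma lnorm_ennreal:
  "0 \<le> a \<Longrightarrow> lnorm (ennreal a) x = (\<Sum>j\<in>UNIV. \<bar>x $ j\<bar> powr a) powr (1 / a)"
  by (simp add: lnorm_def)

lemma lnorm_one: "lnorm 1 x = (\<Sum>j\<in>UNIV. \<bar>x $ j\<bar>)"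
  using lnorm_ennreal[of 1 x] by (simp add: sum_nonneg)

lemma lnorm_powr:
  assumes "0 < a"
  shows "lnorm (ennreal a) x powr a = (\<Sum>j\<in>UNIV. \<bar>x $ j\<bar> powr a)"
  using assms by (simp add: lnorm_ennreal powr_powr sum_nonneg)

lemma lnorm_nonneg: "0 \<le> lnorm r x"
proof (cases "r = \<infinity>")
  case True
  \<comment> \<open>Index types are inhabited, so \<open>undefined\<close> serves as some coordinate
    below which the maximum cannot fall.\<close>
  have "0 \<le> \<bar>x $ undefined\<bar>" by simp
  also have "\<dots> \<le> Max (range (\<lambda>j. \<bar>x $ j\<bar>))" by (intro Max_ge) auto
  finally show ?thesis using True by (simp add: lnorm_top)
qed (simp add: lnorm_def)

lemma exponent_cases:
  fixes r :: ennreal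
  assumes "1 \<le> r"
  obtains "r = \<infinity>" | a where "r = ennreal a" "1 \<le> a"
  using assms by (cases r) (auto simp: ennreal_1[symmetric] simp del: ennreal_1)

text \<open>This has two uses: a vector of norm 0 is 0, and a bound on the \<open>p\<close>-norm
  becomes the coordinatewise bound that dithering requires.\<close>

lemma component_le_lnorm:
  assumes "1 \<le> r"
  shows "\<bar>x $ j\<bar> \<le> lnorm r x"
  using assms
proof (cases r rule: exponent_cases)
  case 1
  then show ?thesis by (auto simp: lnorm_top intro!: Max_ge)
next
  case (2 a)
  have "\<bar>x $ j\<bar> = (\<bar>x $ j\<bar> powr a) powr (1 / a)" using 2 by (simp add: powr_powr)
  also have "\<dots> \<le> (\<Sum>j\<in>UNIV. \<bar>x $ j\<bar> powr a) powr (1 / a)"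
    using 2 by (intro powr_mono2 member_le_sum) auto
  finally show ?thesis using 2 by (simp add: lnorm_ennreal)
qed

lemma lnorm_scaleR:
  assumes "1 \<le> r"
  shows "lnorm r (c *\<^sub>R x) = \<bar>c\<bar> * lnorm r x"
  using assms
proof (cases r rule: exponent_cases)
  case 1
  have "Max ((*) \<bar>c\<bar> ` range (\<lambda>j. \<bar>x $ j\<bar>)) = \<bar>c\<bar> * Max (range (\<lambda>j. \<bar>x $ j\<bar>))"
    by (rule mono_Max_commute[symmetric]) (auto intro!: monoI mult_left_mono)
  then show ?thesis using 1 by (simp add: lnorm_top image_image abs_mult)
next
  case (2 a)
  then have "lnorm r (c *\<^sub>R x) = (\<bar>c\<bar> powr a * (\<Sum>j\<in>UNIV. \<bar>x $ j\<bar> powr a)) powr (1 / a)"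
    by (simp add: lnorm_ennreal abs_mult powr_mult sum_distrib_left)
  also have "\<dots> = \<bar>c\<bar> * lnorm r x"
    using 2 by (simp add: lnorm_ennreal powr_mult powr_powr sum_nonneg)
  finally show ?thesis .
qed

lemma lnorm_zero: "1 \<le> r \<Longrightarrow> lnorm r 0 = 0"
  using lnorm_scaleR[of r 0 0] by simp

lemma lnorm_measurable[measurable]: "lnorm r \<in> borel_measurable borel"
proof -
  have [measurable]: "(\<lambda>x :: real ^ 'd::finite. x $ j) \<in> borel_measurable borel" for j :: "'d::finite"
    by (intro borel_measurable_continuous_onI continuous_intros)
  have "(\<lambda>x :: real ^ 'd::finite. lnorm r x) \<in> borel_measurable borel"
    unfolding lnorm_def by measurable
  then show ?thesis .
qed

locale conjugate_exponents =
  fixes p q :: ennreal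
  assumes p_ge_1: "1 \<le> p" and q_ge_1: "1 \<le> q" and conjugate: "1 / p + 1 / q = 1"
begin

text \<open>Young's inequality and the powers in the norming vector need two finite exponents above
  1, so the endpoint pairs are split off. In \<open>ennreal\<close> the one equation covers them
  too, since \<open>1 / \<infinity> = 0\<close>.\<close>

lemma conjugate_cases:
  obtains "p = 1" "q = \<infinity>" | "p = \<infinity>" "q = 1"
  | a b where "p = ennreal a" "q = ennreal b" "1 < a" "1 < b" "1 / a + 1 / b = 1"
using p_ge_1
proof (cases p rule: exponent_cases)
  case 1
  then have "inverse q = 1" using conjugate by (simp add: divide_ennreal_def)
  with q_ge_1 have "q = 1"
    by (cases q rule: exponent_cases) (simp_all add: inverse_ennreal)
  with 1 that show ?thesis by blast
next
  case (2 a)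
  note a = this
  show ?thesis
    using q_ge_1
  proof (cases q rule: exponent_cases)
    case 1
    then have "inverse p = 1" using conjugate by (simp add: divide_ennreal_def)
    with p_ge_1 have "p = 1"
    by (cases p rule: exponent_cases) (simp_all add: inverse_ennreal)
    with 1 that show ?thesis by blast
  next
    case (2 b)
    have eq: "1 / a + 1 / b = 1"
    proof -
      have "ennreal (1 / a + 1 / b) = ennreal 1"
        using a 2 conjugate by (simp add: ennreal_plus divide_ennreal[symmetric] del: ennreal_plus[symmetric])
      then show ?thesis using a 2 by (subst (asm) ennreal_inj) auto
    qed
    have "1 < a" "1 < b"
      using eq a 2 by (smt (verit) divide_le_eq_1 zero_less_divide_1_iff div_by_1)+
    then show ?thesis using that a 2 eq by blast
  qed
qed

text \<open>At the endpoints the maximum norm is pulled out of the sum. Otherwise both vectors are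
  normalised and Young's inequality is applied entrywise; the resulting bounds add up to
  \<open>1 / a + 1 / b = 1\<close>.\<close>

lemma Holder_inequality: "x \<bullet> y \<le> lnorm p x * lnorm q y"
proof (cases rule: conjugate_cases)
  case 1
  have "x \<bullet> y \<le> (\<Sum>j\<in>UNIV. \<bar>x $ j\<bar> * \<bar>y $ j\<bar>)"
    unfolding inner_vec_def by (intro sum_mono) (simp add: abs_mult[symmetric])
  also have "\<dots> \<le> (\<Sum>j\<in>UNIV. \<bar>x $ j\<bar> * lnorm q y)"
    by (intro sum_mono mult_left_mono component_le_lnorm q_ge_1) auto
  finally show ?thesis using 1 by (simp add: lnorm_one sum_distrib_right)
next
  case 2
  have "x \<bullet> y \<le> (\<Sum>j\<in>UNIV. \<bar>x $ j\<bar> * \<bar>y $ j\<bar>)"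
    unfolding inner_vec_def by (intro sum_mono) (simp add: abs_mult[symmetric])
  also have "\<dots> \<le> (\<Sum>j\<in>UNIV. lnorm p x * \<bar>y $ j\<bar>)"
    by (intro sum_mono mult_right_mono component_le_lnorm p_ge_1) auto
  finally show ?thesis using 2 by (simp add: lnorm_one sum_distrib_left)
next
  case (3 a b)
  show ?thesis
  proof (cases "lnorm p x = 0 \<or> lnorm q y = 0")
    case True
    then have "x = 0 \<or> y = 0"
      using component_le_lnorm[OF p_ge_1, of x] component_le_lnorm[OF q_ge_1, of y]
      by (auto simp: vec_eq_iff)
    then show ?thesis by (auto simp: lnorm_nonneg)
  next
    case False
    then have pos: "0 < lnorm p x" "0 < lnorm q y"
      using lnorm_nonneg[of p x] lnorm_nonneg[of q y] by linarith+
    let ?u = "\<lambda>j. \<bar>x $ j\<bar> / lnorm p x" and ?v = "\<lambda>j. \<bar>y $ j\<bar> / lnorm q y"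
    have "(x \<bullet> y) / (lnorm p x * lnorm q y) \<le> (\<Sum>j\<in>UNIV. ?u j * ?v j)"
      unfolding inner_vec_def sum_divide_distrib
      using pos by (intro sum_mono) (simp add: abs_mult[symmetric] divide_right_mono)
    also have "\<dots> \<le> (\<Sum>j\<in>UNIV. ?u j powr a / a + ?v j powr b / b)"
      using 3 pos by (intro sum_mono Youngs_inequality) auto
    also have "\<dots> = (\<Sum>j\<in>UNIV. \<bar>x $ j\<bar> powr a) / lnorm p x powr a / a
        + (\<Sum>j\<in>UNIV. \<bar>y $ j\<bar> powr b) / lnorm q y powr b / b"
      using pos by (simp add: sum.distrib powr_divide sum_divide_distrib)
    also have "\<dots> = 1"
      using 3 pos by (simp add: lnorm_powr[symmetric])
    finally show ?thesis using pos by (simp add: divide_le_eq)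
  qed
qed

text \<open>The supremum in the dual description of the \<open>p\<close>-norm is attained: by the
  signs of \<open>a\<close>, by a signed unit vector at a largest entry, or by the equality case of
  Hoelder's inequality. The witness later yields the triangle inequality and a steepest descent
  direction.\<close>

lemma dual_vector:
  obtains h where "lnorm q h \<le> 1" "a \<bullet> h = lnorm p a"
proof (cases "a = 0")
  case True
  then show ?thesis
    using that[of 0] by (simp add: lnorm_zero p_ge_1 q_ge_1)
next
  case nz: False
  then obtain j0 where "a $ j0 \<noteq> 0" by (auto simp: vec_eq_iff)
  then have N: "0 < lnorm p a" using component_le_lnorm[OF p_ge_1, of a j0] by linarith
  show ?thesis
  proof (cases rule: conjugate_cases)
    case 1
    have "lnorm q (sign_vec a) \<le> 1"
      using 1 by (auto simp: lnorm_top sign_vec_def abs_sgn_eq)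
    moreover have "a \<bullet> sign_vec a = lnorm p a"
      using 1 by (simp add: lnorm_one inner_vec_def sign_vec_def abs_sgn)
    ultimately show ?thesis by (rule that)
  next
    case 2
    have "Max (range (\<lambda>j. \<bar>a $ j\<bar>)) \<in> range (\<lambda>j. \<bar>a $ j\<bar>)" by (rule Max_in) auto
    then obtain k where "Max (range (\<lambda>j. \<bar>a $ j\<bar>)) = \<bar>a $ k\<bar>" by (rule rangeE)
    then have k: "lnorm p a = \<bar>a $ k\<bar>" using 2 by (simp add: lnorm_top)
    have "\<bar>(axis k (sgn (a $ k)) :: real ^ 'a) $ j\<bar> = (if j = k then \<bar>sgn (a $ k)\<bar> else 0)" for j
      by (simp add: axis_def)
    then have "lnorm q (axis k (sgn (a $ k))) \<le> 1"
      using 2 by (simp add: lnorm_one sgn_if)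
    moreover have "a \<bullet> axis k (sgn (a $ k)) = lnorm p a"
      using k by (simp add: inner_axis abs_sgn)
    ultimately show ?thesis by (rule that)
  next
    case (3 s t)
    \<comment> \<open>Equality in Hoelder's inequality asks for
      \<open>\<bar>h $ j\<bar> powr t\<close> proportional to
      \<open>\<bar>a $ j\<bar> powr s\<close>. As \<open>(s - 1) * t = s\<close>, the entries of
      \<open>h\<close> carry the power \<open>s - 1\<close>, and division by \<open>c\<close> makes
      its norm 1.\<close>
    define c where "c = lnorm p a powr (s - 1)"
    define h where "h = (\<chi> j. sgn (a $ j) * \<bar>a $ j\<bar> powr (s - 1) / c)"
    have c: "0 < c" using N by (simp add: c_def)
    have st: "(s - 1) * t = s"
      using 3(3-5) by (simp add: field_simps)
    have "\<bar>h $ j\<bar> powr t = \<bar>a $ j\<bar> powr s / lnorm p a powr s" for j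
      using c N 3(3) by (cases "a $ j = 0")
        (simp_all add: h_def c_def abs_mult abs_sgn_eq powr_divide powr_powr st)
    then have "(\<Sum>j\<in>UNIV. \<bar>h $ j\<bar> powr t) = (\<Sum>j\<in>UNIV. \<bar>a $ j\<bar> powr s) / lnorm p a powr s"
      by (simp add: sum_divide_distrib)
    also have "\<dots> = 1"
      using 3 N by (simp add: lnorm_powr[symmetric])
    finally have "lnorm q h \<le> 1" using 3 by (simp add: lnorm_ennreal)
    moreover have "a \<bullet> h = lnorm p a"
    proof -
      have "a $ j * h $ j = \<bar>a $ j\<bar> powr s / c" for j
      proof -
        have "a $ j * h $ j = \<bar>a $ j\<bar> * \<bar>a $ j\<bar> powr (s - 1) / c"
          by (simp add: h_def abs_sgn)
        also have "\<bar>a $ j\<bar> * \<bar>a $ j\<bar> powr (s - 1) = \<bar>a $ j\<bar> powr s"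
          by (simp add: powr_mult_base)
        finally show ?thesis .
      qed
      then have "a \<bullet> h = (\<Sum>j\<in>UNIV. \<bar>a $ j\<bar> powr s) / c"
        by (simp add: inner_vec_def sum_divide_distrib)
      also have "\<dots> = lnorm p a powr s / c"
        using 3 by (simp add: lnorm_powr)
      also have "\<dots> = lnorm p a"
        using N by (simp add: c_def powr_diff)
      finally show ?thesis .
    qed
    ultimately show ?thesis by (rule that)
  qed
qed

text \<open>Minkowski's inequality by duality: the norming vector of the sum is tested against each
  summand.\<close>

lemma lnorm_triangle: "lnorm p (a + b) \<le> lnorm p a + lnorm p b"
proof -
  obtain h where h: "lnorm q h \<le> 1" "(a + b) \<bullet> h = lnorm p (a + b)"
    by (rule dual_vector)
  have "v \<bullet> h \<le> lnorm p v" for v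
    using Holder_inequality[of v h] mult_left_mono[OF h(1) lnorm_nonneg[of p v]] by simp
  from this[of a] this[of b] show ?thesis using h(2) by (simp add: inner_add_left)
qed

lemma lnorm_sum: "lnorm p (\<Sum>i\<in>A. v i) \<le> (\<Sum>i\<in>A. lnorm p (v i))"
proof (induction A rule: infinite_finite_induct)
  case (insert i A)
  then show ?case using lnorm_triangle[of "v i" "sum v A"] by simp
qed (simp_all add: lnorm_zero p_ge_1)

end

subsection \<open>Gradients of smooth finite sums\<close>

text \<open>\<open>grad\<close> is a definite description and needs a witness. The adjoint of the
  derivative, applied to 1, is the vector representing this linear functional.\<close>

lemma GDERIV_grad:
  fixes f :: "'a::euclidean_space \<Rightarrow> real"
  assumes "f differentiable (at x)"
  shows "GDERIV f x :> grad f x"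
proof -
  obtain f' where f': "(f has_derivative f') (at x)"
    using assms by (auto simp: differentiable_def)
  have "f' h = h \<bullet> adjoint f' 1" for h
    using adjoint_works[OF has_derivative_linear[OF f'], of h 1] by simp
  then have "f' = (\<lambda>h. h \<bullet> adjoint f' 1)" by blast
  with f' have "GDERIV f x :> adjoint f' 1" by (simp add: gderiv_def)
  then show ?thesis by (simp add: grad_eqI)
qed

lemma GDERIV_line:
  assumes "GDERIV f (x + s *\<^sub>R h) :> g"
  shows "((\<lambda>s. f (x + s *\<^sub>R h)) has_real_derivative g \<bullet> h) (at s)"
proof -
  have "((\<lambda>s. x + s *\<^sub>R h) has_derivative (\<lambda>t. t *\<^sub>R h)) (at s)"
    by (auto intro!: derivative_eq_intros)
  from has_derivative_compose[OF this, of f "\<lambda>v. v \<bullet> g"] assms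
  have "((\<lambda>s. f (x + s *\<^sub>R h)) has_derivative (\<lambda>t. (t *\<^sub>R h) \<bullet> g)) (at s)"
    by (simp add: gderiv_def)
  then show ?thesis
    by (rule has_derivative_imp_has_field_derivative) (simp add: inner_commute)
qed

text \<open>Restriction to the line through \<open>x\<close> and \<open>y\<close> reduces this to
  the tangent inequality on the reals, used between the parameters 0 and 1.\<close>

lemma convex_on_GDERIV_above_tangent:
  fixes f :: "'a::real_inner \<Rightarrow> real"
  assumes "convex_on UNIV f" "GDERIV f x :> g"
  shows "f x + g \<bullet> (y - x) \<le> f y"
proof -
  have "convex_on UNIV (\<lambda>s. f (x + s *\<^sub>R (y - x)))"
  proof (rule convex_onI)
    fix t a b :: real assume t: "0 < t" "t < 1"
    have "x + ((1 - t) *\<^sub>R a + t *\<^sub>R b) *\<^sub>R (y - x)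
        = (1 - t) *\<^sub>R (x + a *\<^sub>R (y - x)) + t *\<^sub>R (x + b *\<^sub>R (y - x))"
      by (simp add: algebra_simps)
    then show "f (x + ((1 - t) *\<^sub>R a + t *\<^sub>R b) *\<^sub>R (y - x))
        \<le> (1 - t) * f (x + a *\<^sub>R (y - x)) + t * f (x + b *\<^sub>R (y - x))"
      using convex_onD[OF assms(1), of t] t by simp
  qed simp
  moreover have "((\<lambda>s. f (x + s *\<^sub>R (y - x))) has_real_derivative g \<bullet> (y - x)) (at 0)"
    by (rule GDERIV_line) (simp add: assms(2))
  ultimately have "g \<bullet> (y - x) * (1 - 0) \<le> f (x + 1 *\<^sub>R (y - x)) - f (x + 0 *\<^sub>R (y - x))"
    by (intro convex_on_imp_above_tangent[where A = UNIV]) auto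
  then show ?thesis by simp
qed

locale smooth_convex_finite_sum = conjugate_exponents p q for p q :: ennreal +
  fixes n :: nat and f :: "nat \<Rightarrow> real ^ 'd \<Rightarrow> real" and L :: real and xstar :: "real ^ 'd"
  assumes n_pos: "1 \<le> n"
    and cont_diff: "i \<in> {1..n} \<Longrightarrow> continuously_differentiable (f i)"
    and L_pos: "0 < L"
    and smooth: "i \<in> {1..n} \<Longrightarrow> lnorm p (grad (f i) y - grad (f i) z) \<le> L * lnorm q (y - z)"
    and convex: "convex_on UNIV (average n f)"
    and minimizer: "average n f xstar \<le> average n f y"
begin

abbreviation F :: "real ^ 'd \<Rightarrow> real" where "F \<equiv> average n f"

lemma GDERIV_component: "i \<in> {1..n} \<Longrightarrow> GDERIV (f i) x :> grad (f i) x"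
  using cont_diff by (auto simp: continuously_differentiable_def intro: GDERIV_grad)

lemma GDERIV_average: "GDERIV F x :> (1 / real n) *\<^sub>R (\<Sum>i = 1..n. grad (f i) x)"
proof -
  have "((\<lambda>x. (1 / real n) * (\<Sum>i = 1..n. f i x)) has_derivative
      (\<lambda>h. (1 / real n) * (\<Sum>i = 1..n. h \<bullet> grad (f i) x))) (at x)"
    using GDERIV_component
    by (intro has_derivative_mult_right has_derivative_sum) (simp add: gderiv_def)
  then show ?thesis
    by (simp add: gderiv_def average_def[abs_def] inner_sum_right inner_scaleR_right)
qed

lemma grad_average: "grad F x = (1 / real n) *\<^sub>R (\<Sum>i = 1..n. grad (f i) x)"
  using GDERIV_average by (rule grad_eqI)

lemma GDERIV_F: "GDERIV F x :> grad F x"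
  using GDERIV_average by (simp add: grad_average)

lemma continuous_F: "continuous_on UNIV F"
  using GDERIV_F has_derivative_continuous
  unfolding gderiv_def continuous_on_eq_continuous_at[OF open_UNIV] by blast

lemma grad_measurable: "i \<in> {1..n} \<Longrightarrow> grad (f i) \<in> borel_measurable borel"
  using cont_diff by (auto simp: continuously_differentiable_def intro: borel_measurable_continuous_onI)

lemma grad_F_measurable[measurable]: "grad F \<in> borel_measurable borel"
proof -
  have "continuous_on UNIV (\<lambda>x. (1 / real n) *\<^sub>R (\<Sum>i = 1..n. grad (f i) x))"
    using cont_diff by (intro continuous_intros) (auto simp: continuously_differentiable_def)
  then show ?thesis by (auto simp: grad_average[abs_def] intro: borel_measurable_continuous_onI)
qed

lemma lnorm_grad_F_diff: "lnorm p (grad F y - grad F z) \<le> L * lnorm q (y - z)"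
proof -
  have "lnorm p (grad F y - grad F z)
      = (1 / real n) * lnorm p (\<Sum>i = 1..n. grad (f i) y - grad (f i) z)"
    by (simp add: grad_average lnorm_scaleR[OF p_ge_1] sum_subtractf flip: scaleR_diff_right)
  also have "\<dots> \<le> (1 / real n) * (\<Sum>i = 1..n. L * lnorm q (y - z))"
    by (intro mult_left_mono order_trans[OF lnorm_sum] sum_mono smooth) auto
  also have "\<dots> = L * lnorm q (y - z)" using n_pos by simp
  finally show ?thesis .
qed

text \<open>Along the segment, the difference \<open>?\<phi>\<close> between \<open>F\<close> and
  its quadratic upper model has nonpositive derivative, by Hoelder's inequality and the Lipschitz
  bound. Monotonicity of \<open>?\<phi>\<close> then takes the place of integrating the
  gradient.\<close>

lemma descent: "F (x + h) \<le> F x + grad F x \<bullet> h + L / 2 * (lnorm q h)\<^sup>2"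
proof -
  let ?\<phi> = "\<lambda>s. F (x + s *\<^sub>R h) - s * (grad F x \<bullet> h) - L / 2 * s\<^sup>2 * (lnorm q h)\<^sup>2"
  have "?\<phi> 1 \<le> ?\<phi> 0"
  proof (rule DERIV_nonpos_imp_nonincreasing[of 0 1 ?\<phi>])
    fix s :: real assume s: "0 \<le> s"
    have "(grad F (x + s *\<^sub>R h) - grad F x) \<bullet> h
        \<le> lnorm p (grad F (x + s *\<^sub>R h) - grad F x) * lnorm q h"
      by (rule Holder_inequality)
    also have "\<dots> \<le> (L * lnorm q (s *\<^sub>R h)) * lnorm q h"
      using lnorm_grad_F_diff[of "x + s *\<^sub>R h" x]
      by (intro mult_right_mono lnorm_nonneg) simp
    also have "\<dots> = L * s * (lnorm q h)\<^sup>2"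
      using s by (simp add: lnorm_scaleR[OF q_ge_1] power2_eq_square)
    finally have "grad F (x + s *\<^sub>R h) \<bullet> h - grad F x \<bullet> h - L * s * (lnorm q h)\<^sup>2 \<le> 0"
      by (simp add: inner_diff_left)
    moreover have "(?\<phi> has_real_derivative
        grad F (x + s *\<^sub>R h) \<bullet> h - grad F x \<bullet> h - L * s * (lnorm q h)\<^sup>2) (at s)"
      by (rule derivative_eq_intros GDERIV_line[OF GDERIV_F] refl | simp)+
    ultimately show "\<exists>y. (?\<phi> has_real_derivative y) (at s) \<and> y \<le> 0" by blast
  qed simp
  then show ?thesis by simp
qed

text \<open>With \<open>g\<close> the \<open>p\<close>-norm of the gradient, the length
  \<open>g / L\<close> minimizes the quadratic model along the norming direction and guarantees a
  decrease of \<open>g^2 / (2 * L)\<close>, which cannot exceed the gap to the minimum.\<close>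

lemma lnorm_grad_le: "lnorm p (grad F x) \<le> sqrt (2 * L * (F x - F xstar))"
proof (rule real_le_rsqrt)
  obtain h where h: "lnorm q h \<le> 1" "grad F x \<bullet> h = lnorm p (grad F x)"
    by (rule dual_vector)
  let ?g = "lnorm p (grad F x)"
  \<comment> \<open>a steepest descent step for the \<open>q\<close>-norm\<close>
  have "F xstar \<le> F (x + (- ?g / L) *\<^sub>R h)" by (rule minimizer)
  also have "\<dots> \<le> F x + grad F x \<bullet> ((- ?g / L) *\<^sub>R h)
      + L / 2 * (lnorm q ((- ?g / L) *\<^sub>R h))\<^sup>2"
    by (rule descent)
  also have "\<dots> = F x - ?g\<^sup>2 / L + ?g\<^sup>2 / (2 * L) * (lnorm q h)\<^sup>2"
  proof -
    have "(lnorm q ((- ?g / L) *\<^sub>R h))\<^sup>2 = ?g\<^sup>2 / L\<^sup>2 * (lnorm q h)\<^sup>2"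
      by (simp only: lnorm_scaleR[OF q_ge_1]) (simp add: power_mult_distrib power_divide)
    then show ?thesis
      using h L_pos by (simp add: power2_eq_square field_simps)
  qed
  also have "\<dots> \<le> F x - ?g\<^sup>2 / L + ?g\<^sup>2 / (2 * L) * 1"
    using h L_pos lnorm_nonneg[of q h]
    by (intro add_left_mono mult_left_mono) (auto intro: power_le_one)
  finally show "?g\<^sup>2 \<le> 2 * L * (F x - F xstar)" using L_pos by (simp add: field_simps)
qed

text \<open>The dither amplitude \<open>G\<close> of a round with iterate \<open>x\<close> and
  reference point \<open>y\<close>, the stored gradient being that at \<open>y\<close>.\<close>

definition scale :: "real ^ 'd \<Rightarrow> real ^ 'd \<Rightarrow> real" where
  "scale x y = L * lnorm q (x - y) + lnorm p (grad F y)"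

lemma scale_nonneg: "0 \<le> scale x y"
  using L_pos by (simp add: scale_def lnorm_nonneg)

text \<open>The factor 2 has two sources: one \<open>L * D\<close> is the distance term of
  \<open>scale\<close> itself, the other is the price of replacing the gradient at \<open>y\<close>
  by the gradient at \<open>x\<close>.\<close>

lemma scale_le:
  assumes "lnorm q (x - y) \<le> D"
  shows "scale x y \<le> 2 * L * D + sqrt (2 * L * (F x - F xstar))"
proof -
  have "lnorm p (grad F y) \<le> lnorm p (grad F x) + lnorm p (grad F y - grad F x)"
    using lnorm_triangle[of "grad F x" "grad F y - grad F x"] by simp
  moreover have "lnorm p (grad F y - grad F x) = lnorm p (grad F x - grad F y)"
    using lnorm_scaleR[OF p_ge_1, of "-1" "grad F x - grad F y"] by simp
  moreover have "L * lnorm q (x - y) \<le> L * D"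
    using assms L_pos by simp
  ultimately show ?thesis
    using lnorm_grad_F_diff[of x y] lnorm_grad_le[of x] by (simp add: scale_def)
qed

text \<open>This explains the choice of \<open>G\<close>: smoothness controls the difference of the
  component gradients, the second summand controls the reference gradient, and the bound is the same
  for every index that may be drawn.\<close>

lemma component_le_scale:
  assumes "i \<in> {1..n}"
  shows "\<bar>(grad (f i) x - grad (f i) y + grad F y) $ j\<bar> \<le> scale x y"
proof -
  have "\<bar>(grad (f i) x - grad (f i) y + grad F y) $ j\<bar>
      \<le> \<bar>(grad (f i) x - grad (f i) y) $ j\<bar> + \<bar>grad F y $ j\<bar>"
    by simp
  also have "\<dots> \<le> scale x y"
    unfolding scale_def using smooth[OF assms, of x y]
    by (intro add_mono order_trans[OF component_le_lnorm[OF p_ge_1]]) auto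
  finally show ?thesis .
qed

lemma gap_le_inner: "F x - F xstar \<le> grad F x \<bullet> (x - xstar)"
  using convex_on_GDERIV_above_tangent[OF convex GDERIV_F, of x xstar]
  by (simp add: inner_diff_right)

end

subsection \<open>Dithered signs\<close>

abbreviation cube_measure :: "(real ^ 'd) measure" where
  "cube_measure \<equiv> uniform_measure lborel (cbox (-1) 1)"

lemma cube_eq_cbox: "{v :: real ^ 'd. \<forall>j. v $ j \<in> {-1..1}} = cbox (-1) 1"
  by (auto simp: mem_box_cart)

lemma measure_cube: "measure lborel (cbox (-1) 1 :: (real ^ 'd) set) = 2 ^ CARD('d)"
proof -
  \<comment> \<open>The product formula for the volume of a box applies to nonempty boxes.\<close>
  have "(0 :: real ^ 'd) \<in> cbox (-1) 1" by (simp add: mem_box_cart)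
  then show ?thesis by (subst content_cbox_cart) auto
qed

lemma emeasure_cube: "emeasure lborel (cbox (-1) 1 :: (real ^ 'd) set) = ennreal (2 ^ CARD('d))"
  using emeasure_lborel_cbox_finite[of "-1" "1 :: real ^ 'd"]
  by (subst emeasure_eq_ennreal_measure) (auto simp: measure_cube)

lemma prob_space_cube: "prob_space (cube_measure :: (real ^ 'd) measure)"
  by (rule prob_space_uniform_measure) (simp_all add: emeasure_cube)

text \<open>Each half-space cuts the cube in a box again, with \<open>j\<close>-th side
  \<open>1 + c\<close> or \<open>1 - c\<close> and all other sides 2, so the probability is a
  quotient of volumes.\<close>

lemma measure_cube_halfspaces:
  assumes "-1 \<le> c" "c \<le> 1"
  shows "measure cube_measure {u :: real ^ 'd. u $ j \<le> c} = (1 + c) / 2"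
    and "measure cube_measure {u :: real ^ 'd. c \<le> u $ j} = (1 - c) / 2"
proof -
  have *: "measure cube_measure A = measure lborel (cbox (-1) 1 \<inter> A) / 2 ^ CARD('d)"
    if "A \<in> sets borel" for A :: "(real ^ 'd) set"
    using that
    by (subst measure_uniform_measure) (simp_all add: emeasure_cube measure_cube)
  have prod: "(\<Prod>k\<in>UNIV. if k = j then a else 2) = 2 ^ CARD('d) * (a / 2)" for a :: real
  proof -
    have "(\<Prod>k\<in>UNIV. if k = j then a else 2) = (\<Prod>k\<in>UNIV. 2 * (if k = j then a / 2 else 1))"
      by (intro prod.cong) auto
    then show ?thesis by (simp only: prod.distrib) (simp add: prod.delta)
  qed
  have meas: "{u :: real ^ 'd. u $ j \<le> c} \<in> sets borel" "{u :: real ^ 'd. c \<le> u $ j} \<in> sets borel"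
    by (auto intro!: borel_closed closed_Collect_le continuous_intros)
  let ?b = "\<chi> k. if k = j then c else 1" and ?a = "\<chi> k. if k = j then c else -1"
  have "cbox (-1) 1 \<inter> {u :: real ^ 'd. u $ j \<le> c} = cbox (-1) ?b"
  proof (intro set_eqI iffI)
    fix u assume u: "u \<in> cbox (-1) ?b"
    then have *: "-1 \<le> u $ k \<and> u $ k \<le> (if k = j then c else 1)" for k
      by (simp add: mem_box_cart)
    have "-1 \<le> u $ k \<and> u $ k \<le> 1" for k
      using *[of k] assms by (auto split: if_splits)
    with *[of j] show "u \<in> cbox (-1) 1 \<inter> {u. u $ j \<le> c}"
      by (simp add: mem_box_cart)
  qed (auto simp: mem_box_cart)
  moreover have "measure lborel (cbox (-1) ?b) = (\<Prod>k\<in>UNIV. if k = j then 1 + c else 2)"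
  proof -
    have "-1 \<in> cbox (-1) ?b" using assms by (simp add: mem_box_cart)
    then show ?thesis by (subst content_cbox_cart) (auto intro!: prod.cong)
  qed
  ultimately show "measure cube_measure {u :: real ^ 'd. u $ j \<le> c} = (1 + c) / 2"
    by (simp add: *[OF meas(1)] prod)
  have "cbox (-1) 1 \<inter> {u :: real ^ 'd. c \<le> u $ j} = cbox ?a 1"
  proof (intro set_eqI iffI)
    fix u assume u: "u \<in> cbox ?a 1"
    then have *: "(if k = j then c else -1) \<le> u $ k \<and> u $ k \<le> 1" for k
      by (simp add: mem_box_cart)
    have "-1 \<le> u $ k \<and> u $ k \<le> 1" for k
      using *[of k] assms by (auto split: if_splits)
    with *[of j] show "u \<in> cbox (-1) 1 \<inter> {u. c \<le> u $ j}"
      by (simp add: mem_box_cart)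
  qed (auto simp: mem_box_cart)
  moreover have "measure lborel (cbox ?a 1) = (\<Prod>k\<in>UNIV. if k = j then 1 - c else 2)"
  proof -
    have "1 \<in> cbox ?a 1" using assms by (simp add: mem_box_cart)
    then show ?thesis by (subst content_cbox_cart) (auto intro!: prod.cong)
  qed
  ultimately show "measure cube_measure {u :: real ^ 'd. c \<le> u $ j} = (1 - c) / 2"
    by (simp add: *[OF meas(2)] prod)
qed

text \<open>The sign flips at \<open>u $ j = - a / G\<close>, which lies in the interval from -1 to
  1 because \<open>\<bar>a\<bar> \<le> G\<close>; the masses on the two sides differ by
  \<open>a / G\<close>. For \<open>G = 0\<close> also \<open>a = 0\<close>, and both sides are
  0.\<close>

lemma expectation_dithered_sgn:
  fixes j :: "'d::finite"
  assumes "\<bar>a\<bar> \<le> G"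
  shows "(\<integral>u. sgn (a + G * u $ j) \<partial>(cube_measure :: (real ^ 'd) measure)) = a / G"
proof (cases "G = 0")
  case True
  then show ?thesis using assms by simp
next
  case False
  then have G: "0 < G" using assms by linarith
  interpret prob_space "cube_measure :: (real ^ 'd) measure" by (rule prob_space_cube)
  let ?c = "- (a / G)"
  have c: "-1 \<le> ?c" "?c \<le> 1" using assms G by (auto simp: field_simps abs_le_iff)
  have meas: "{u :: real ^ 'd. u $ j \<le> ?c} \<in> sets borel" "{u :: real ^ 'd. ?c \<le> u $ j} \<in> sets borel"
    by (auto intro!: borel_closed closed_Collect_le continuous_intros)
  have int: "integrable cube_measure (indicator A :: real ^ 'd \<Rightarrow> real)" if "A \<in> sets borel" for A
    using that by (intro integrable_const_bound[where B = 1]) auto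
  \<comment> \<open>Both half-spaces are closed: on the common boundary the indicators cancel,
    matching \<open>sgn 0 = 0\<close>, so no null set has to be removed.\<close>
  have "sgn (a + G * u $ j)
      = indicator {u. ?c \<le> u $ j} u - indicator {u. u $ j \<le> ?c} u" for u :: "real ^ 'd"
    using G by (auto simp: sgn_if indicator_def field_simps)
  then have "(\<integral>u. sgn (a + G * u $ j) \<partial>cube_measure)
      = (\<integral>u. indicator {u. ?c \<le> u $ j} u - indicator {u. u $ j \<le> ?c} u \<partial>cube_measure)"
    by simp
  also have "\<dots> = measure cube_measure {u. ?c \<le> u $ j} - measure cube_measure {u. u $ j \<le> ?c}"
    using meas by (subst Bochner_Integration.integral_diff) (auto intro: int)
  also have "\<dots> = a / G"
    using measure_cube_halfspaces[OF c, of j] by (simp add: field_simps)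
  finally show ?thesis .
qed

subsection \<open>One step of the algorithm\<close>

text \<open>The squared norm counts the nonzero entries; this is the source of the dimension in the
  final bound.\<close>

lemma norm_sign_vec_le: "(norm (sign_vec (v :: real ^ 'd)))\<^sup>2 \<le> real CARD('d)"
proof -
  have "(norm (sign_vec v))\<^sup>2 = (\<Sum>j\<in>UNIV. (sgn (v $ j))\<^sup>2)"
    by (simp add: norm_eq_sqrt_inner inner_vec_def sign_vec_def power2_eq_square sum_nonneg)
  also have "\<dots> \<le> (\<Sum>j\<in>(UNIV :: 'd set). 1)"
    by (intro sum_mono) (simp add: sgn_if)
  finally show ?thesis by simp
qed

lemma vec_nth_measurable[measurable]:
  "(\<lambda>x :: real ^ 'd::finite. x $ j) \<in> borel_measurable borel"
  by (intro borel_measurable_continuous_onI continuous_intros)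

lemma borel_measurable_vecI:
  fixes f :: "'a \<Rightarrow> real ^ 'd"
  assumes "\<And>j. (\<lambda>x. f x $ j) \<in> borel_measurable M"
  shows "f \<in> borel_measurable M"
  using assms by (subst borel_measurable_euclidean_space) (auto simp: Basis_vec_def inner_axis)

lemma sign_vec_measurable[measurable]: "sign_vec \<in> borel_measurable (borel :: (real ^ 'd) measure)"
proof (rule borel_measurable_vecI)
  fix j :: 'd
  have "(\<lambda>x :: real ^ 'd. sgn (x $ j)) \<in> borel_measurable borel" by measurable
  then show "(\<lambda>x :: real ^ 'd. sign_vec x $ j) \<in> borel_measurable borel" by (simp add: sign_vec_def)
qed

section \<open>The law of one update direction\<close>

context smooth_convex_finite_sum
begin

text \<open>A state is a pair of the iterate and the reference point, a noise sample a pair of the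
  index and the dithering vector.\<close>

definition direction :: "(real ^ 'd) \<times> (real ^ 'd) \<Rightarrow> nat \<times> (real ^ 'd) \<Rightarrow> real ^ 'd" where
  "direction z w = sign_vec (grad (f (fst w)) (fst z) - grad (f (fst w)) (snd z) + grad F (snd z)
     + scale (fst z) (snd z) *\<^sub>R snd w)"

definition noise :: "(nat \<times> (real ^ 'd)) measure" where
  "noise = uniform_count_measure {1..n} \<Otimes>\<^sub>M cube_measure"

abbreviation noise_space :: "(nat \<times> (real ^ 'd)) measure" where
  "noise_space \<equiv> count_space {1..n} \<Otimes>\<^sub>M borel"

lemma sets_noise[measurable_cong]: "sets noise = sets noise_space"
  unfolding noise_def
  by (intro sets_pair_measure_cong) (simp_all add: sets_uniform_count_measure_count_space)

lemma prob_space_noise: "prob_space noise"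
proof -
  interpret A: prob_space "uniform_count_measure {1..n}"
    using n_pos by (intro prob_space_uniform_count_measure) auto
  interpret B: prob_space "cube_measure :: (real ^ 'd) measure" by (rule prob_space_cube)
  interpret pair_prob_space "uniform_count_measure {1..n}" "cube_measure :: (real ^ 'd) measure" ..
  show ?thesis unfolding noise_def by (rule prob_space_axioms)
qed

lemma scale_measurable[measurable]:
  "(\<lambda>z. scale (fst z) (snd z)) \<in> borel_measurable (borel \<Otimes>\<^sub>M borel)"
  unfolding scale_def by measurable

text \<open>The index selects one of the functions \<open>f i\<close>, so measurability is shown
  with the index frozen and then glued over its finitely many values.\<close>

lemma direction_measurable[measurable]:
  "(\<lambda>(z, w). direction z w) \<in> (borel \<Otimes>\<^sub>M borel) \<Otimes>\<^sub>M noise_space \<rightarrow>\<^sub>M borel"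
proof -
  have "(\<lambda>zw. (\<lambda>i zw. direction (fst zw) (i, snd (snd zw))) (fst (snd zw)) zw)
      \<in> (borel \<Otimes>\<^sub>M borel) \<Otimes>\<^sub>M noise_space \<rightarrow>\<^sub>M borel"
  proof (rule measurable_compose_countable'[where I = "{1..n}"])
    fix i assume "i \<in> {1..n}"
    then have [measurable]: "grad (f i) \<in> borel_measurable borel" by (rule grad_measurable)
    show "(\<lambda>zw. direction (fst zw) (i, snd (snd zw)))
        \<in> (borel \<Otimes>\<^sub>M borel) \<Otimes>\<^sub>M noise_space \<rightarrow>\<^sub>M borel"
      unfolding direction_def fst_conv snd_conv by measurable
  qed auto
  then show ?thesis by (simp add: case_prod_beta')
qed

lemma integrable_direction_nth: "integrable noise (\<lambda>w. direction (x, y) w $ j)"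
proof -
  interpret N: prob_space noise by (rule prob_space_noise)
  have [measurable]: "direction (x, y) \<in> noise_space \<rightarrow>\<^sub>M borel"
    using measurable_Pair2[OF direction_measurable, of "(x, y)"] by (simp add: space_pair_measure)
  have "\<bar>direction (x, y) w $ j\<bar> \<le> 1" for w
    by (simp add: direction_def sign_vec_def sgn_if)
  moreover have "(\<lambda>w. direction (x, y) w $ j) \<in> borel_measurable noise"
    by measurable
  ultimately show ?thesis
    by (intro N.integrable_const_bound[where B = 1] AE_I2) simp_all
qed

text \<open>The dithering makes the sign an unbiased estimator of the rescaled stochastic gradient, and
  the control variates average to zero.  If the scale vanishes then so does the stochastic
  gradient, and both sides are zero.\<close>

lemma expectation_direction_nth:
  "(\<integral>w. direction (x, y) w $ j \<partial>noise) = grad F x $ j / scale x y"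
proof -
  interpret A: prob_space "uniform_count_measure {1..n}"
    using n_pos by (intro prob_space_uniform_count_measure) auto
  interpret B: prob_space "cube_measure :: (real ^ 'd) measure" by (rule prob_space_cube)
  interpret pair_prob_space "uniform_count_measure {1..n}" "cube_measure :: (real ^ 'd) measure" ..
  note int = integrable_direction_nth[of x y j]
  define v where "v i = grad (f i) x - grad (f i) y + grad F y" for i
  have "(\<integral>w. direction (x, y) w $ j \<partial>noise)
      = (\<integral>i. (\<integral>u. direction (x, y) (i, u) $ j \<partial>cube_measure) \<partial>uniform_count_measure {1..n})"
    using int unfolding noise_def by (rule integral_fst'[symmetric])
  also have "\<dots> = (\<Sum>i = 1..n. \<integral>u. direction (x, y) (i, u) $ j \<partial>cube_measure) / real n"
    by (subst integral_uniform_count_measure) auto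
  also have "\<dots> = (\<Sum>i = 1..n. v i $ j / scale x y) / real n"
  proof (intro arg_cong2[where f = "(/)"] sum.cong refl)
    fix i assume "i \<in> {1..n}"
    then have "\<bar>v i $ j\<bar> \<le> scale x y" unfolding v_def by (rule component_le_scale)
    moreover have "direction (x, y) (i, u) $ j = sgn (v i $ j + scale x y * u $ j)" for u
      by (simp add: direction_def sign_vec_def v_def)
    ultimately show "(\<integral>u. direction (x, y) (i, u) $ j \<partial>cube_measure) = v i $ j / scale x y"
      by (simp add: expectation_dithered_sgn)
  qed
  also have "\<dots> = ((1 / real n) *\<^sub>R (\<Sum>i = 1..n. v i)) $ j / scale x y"
    by (simp add: sum_divide_distrib mult.commute)
  also have "(1 / real n) *\<^sub>R (\<Sum>i = 1..n. v i) = grad F x"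
  proof -
    have "(\<Sum>i = 1..n. v i) = (\<Sum>i = 1..n. grad (f i) x) - (\<Sum>i = 1..n. grad (f i) y)
        + real n *\<^sub>R grad F y"
      by (simp add: v_def sum.distrib sum_subtractf sum_constant_scaleR del: sum_constant)
    also have "real n *\<^sub>R grad F y = (\<Sum>i = 1..n. grad (f i) y)"
      using n_pos by (simp add: grad_average)
    finally show ?thesis by (simp add: grad_average)
  qed
  finally show ?thesis .
qed

lemma expectation_direction_inner:
  "(\<integral>w. direction (x, y) w \<bullet> h \<partial>noise) = (grad F x \<bullet> h) / scale x y"
proof -
  show ?thesis
    using integrable_direction_nth by (simp add: inner_vec_def expectation_direction_nth sum_divide_distrib)
qed

definition gap_ratio :: "real \<Rightarrow> real ^ 'd \<Rightarrow> real" where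
  "gap_ratio D x = (F x - F xstar) / (2 * L * D + sqrt (2 * L * (F x - F xstar)))"

text \<open>Convexity bounds the gap by the inner product, and since the gap is nonnegative,
  enlarging the denominator from \<open>scale x y\<close> to that of \<open>gap_ratio\<close> only
  decreases the quotient.\<close>

lemma gap_ratio_le:
  assumes "0 < D" "lnorm q (x - y) \<le> D"
  shows "gap_ratio D x \<le> (\<integral>w. direction (x, y) w \<bullet> (x - xstar) \<partial>noise)"
proof (cases "scale x y = 0")
  case True
  then have "lnorm q (x - y) = 0" "lnorm p (grad F y) = 0"
    using L_pos lnorm_nonneg[of q "x - y"] lnorm_nonneg[of p "grad F y"]
    by (auto simp: scale_def add_nonneg_eq_0_iff)
  \<comment> \<open>Thus \<open>x\<close> is its own reference point and stationary; convexity makes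
    it a minimizer, and both sides are 0.\<close>
  then have "x - y = 0" "grad F y = 0"
    using component_le_lnorm[OF q_ge_1, of "x - y"] component_le_lnorm[OF p_ge_1, of "grad F y"]
    by (auto simp: vec_eq_iff)
  then have "F x = F xstar" using gap_le_inner[of x] minimizer[of x] by simp
  then show ?thesis using True by (simp add: gap_ratio_def expectation_direction_inner)
next
  case False
  then have "0 < scale x y" using scale_nonneg[of x y] by simp
  then have "gap_ratio D x \<le> (F x - F xstar) / scale x y"
    unfolding gap_ratio_def using scale_le[OF assms(2)] minimizer[of x]
    by (intro divide_left_mono) auto
  also have "\<dots> \<le> (grad F x \<bullet> (x - xstar)) / scale x y"
    using \<open>0 < scale x y\<close> gap_le_inner by (intro divide_right_mono) auto
  finally show ?thesis by (simp add: expectation_direction_inner)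
qed

text \<open>\<open>D > 0\<close> keeps the denominator positive even at minimizers. Continuity
  provides measurability, and boundedness on the ball containing the iterates.\<close>

lemma continuous_gap_ratio:
  assumes "0 < D"
  shows "continuous_on UNIV (gap_ratio D)"
proof -
  have "0 < 2 * L * D + sqrt (2 * L * (F x - F xstar))" for x
    using assms L_pos minimizer[of x] by (intro add_pos_nonneg) auto
  then show ?thesis
    unfolding gap_ratio_def[abs_def]
    by (intro continuous_intros continuous_F) (metis less_irrefl)
qed

end

section \<open>Pathwise behaviour for a fixed noise sequence\<close>

locale sign_svrg_run = smooth_convex_finite_sum p q n f L xstar
  for p q :: ennreal and n :: nat and f :: "nat \<Rightarrow> real ^ 'd \<Rightarrow> real" and L :: real
    and xstar :: "real ^ 'd" +
  fixes D \<gamma> :: real and x1 :: "real ^ 'd"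
  assumes D_pos: "0 < D" and \<gamma>_pos: "0 < \<gamma>"
begin

definition run :: "(nat \<Rightarrow> nat \<times> (real ^ 'd)) \<Rightarrow> nat \<Rightarrow> 'd svrg_state" where
  "run w = sign_svrg n f p q L D \<gamma> x1 (\<lambda>s. fst (w s)) (\<lambda>s. snd (w s))"

text \<open>These two vectors suffice for a recursion: the stored gradient is a function of the
  reference point, so the next pair depends on the current pair and fresh noise alone.\<close>

definition state :: "nat \<Rightarrow> (nat \<Rightarrow> nat \<times> (real ^ 'd)) \<Rightarrow> (real ^ 'd) \<times> (real ^ 'd)" where
  "state t w = (iterate (run w t), ref_point (run w t))"

lemma ref_grad_run: "ref_grad (run w t) = grad F (ref_point (run w t))"
proof (induction t rule: nat_induct)
  case (Suc t)
  \<comment> \<open>The case \<open>t = 0\<close> is separate, as the indices 0 and 1 both carry the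
    initial state.\<close>
  then show ?case
    by (cases t) (simp_all add: run_def svrg_init_def svrg_step_def Let_def)
qed (simp add: run_def svrg_init_def)

lemma state_init: "state (Suc 0) w = (x1, x1)"
  by (simp add: state_def run_def svrg_init_def)

lemma state_Suc:
  assumes "1 \<le> t"
  shows "state (Suc t) w =
    (let (x, y) = state t w; x' = x - \<gamma> *\<^sub>R direction (x, y) (w t)
     in (x', if lnorm q (x' - y) \<le> D then y else x'))"
proof -
  obtain t' where "t = Suc t'" using assms by (cases t) auto
  then show ?thesis
    using ref_grad_run[of w t]
    by (simp add: state_def run_def svrg_step_def direction_def scale_def Let_def)
qed

text \<open>Either the distance test has just succeeded, or the reference point has been moved onto
  the iterate and the distance is 0.\<close>

lemma state_near_reference:
  assumes "1 \<le> t"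
  shows "lnorm q (fst (state t w) - snd (state t w)) \<le> D"
  using assms
proof (induction t rule: dec_induct)
  case base
  then show ?case using D_pos by (simp add: state_init lnorm_zero q_ge_1)
next
  case (step t)
  then show ?case
    using D_pos by (simp add: state_Suc Let_def case_prod_beta lnorm_zero q_ge_1)
qed

text \<open>Adaptedness in deterministic form: the sample \<open>w t\<close> is first consumed in
  passing from \<open>t\<close> to \<open>Suc t\<close>. This separates the past from the current
  noise.\<close>

lemma state_cong:
  assumes "1 \<le> t" "\<And>s. s \<in> {1..<t} \<Longrightarrow> w s = w' s"
  shows "state t w = state t w'"
  using assms
proof (induction t rule: dec_induct)
  case base
  show ?case by (simp add: state_init)
next
  case (step t)
  then have "state t w = state t w'" "w t = w' t" by auto
  then show ?case using step(1) by (simp add: state_Suc)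
qed

text \<open>A larger index set \<open>J\<close> is allowed so that the product space stays the same
  throughout the induction on \<open>t\<close>.\<close>

lemma state_measurable:
  assumes "1 \<le> t" "{1..<t} \<subseteq> J"
  shows "state t \<in> PiM J (\<lambda>_. noise_space) \<rightarrow>\<^sub>M borel \<Otimes>\<^sub>M borel"
  using assms
proof (induction t rule: dec_induct)
  case base
  have "state (Suc 0) = (\<lambda>_. (x1, x1))" by (simp add: fun_eq_iff state_init)
  then show ?case by simp
next
  case (step t)
  let ?P = "PiM J (\<lambda>_. noise_space)"
  have [measurable]: "state t \<in> ?P \<rightarrow>\<^sub>M borel \<Otimes>\<^sub>M borel"
  proof (rule step.IH)
    show "{1..<t} \<subseteq> J" using step.prems by auto
  qed
  have "t \<in> J" using step.prems step.hyps by auto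
  then have [measurable]: "(\<lambda>w. w t) \<in> ?P \<rightarrow>\<^sub>M noise_space" by (rule measurable_component_singleton)
  have "(\<lambda>w. (case_prod direction) (state t w, w t)) \<in> ?P \<rightarrow>\<^sub>M borel"
    by measurable
  then have [measurable]: "(\<lambda>w. direction (state t w) (w t)) \<in> ?P \<rightarrow>\<^sub>M borel" by simp
  have "state (Suc t) = (\<lambda>w. (fst (state t w) - \<gamma> *\<^sub>R direction (state t w) (w t),
      if lnorm q (fst (state t w) - \<gamma> *\<^sub>R direction (state t w) (w t) - snd (state t w)) \<le> D
      then snd (state t w) else fst (state t w) - \<gamma> *\<^sub>R direction (state t w) (w t)))"
    using step(1) by (auto simp: fun_eq_iff state_Suc Let_def case_prod_beta)
  then show ?case by (rule ssubst) measurable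
qed

text \<open>A step moves the iterate by at most \<open>\<gamma> * sqrt d\<close>. The crude bound
  serves integrability: up to any given round the iterates stay in a deterministic ball.\<close>

lemma state_bounded:
  assumes "1 \<le> t"
  shows "norm (fst (state t w)) \<le> norm x1 + real t * (\<gamma> * sqrt (real CARD('d)))"
  using assms
proof (induction t rule: dec_induct)
  case base
  then show ?case using \<gamma>_pos by (simp add: state_init)
next
  case (step t)
  have "norm (fst (state (Suc t) w)) \<le> norm (fst (state t w)) + \<gamma> * norm (direction (state t w) (w t))"
    using step(1) \<gamma>_pos norm_triangle_ineq4[of "fst (state t w)" "\<gamma> *\<^sub>R direction (state t w) (w t)"]
    by (simp add: state_Suc Let_def case_prod_beta)
  also have "norm (direction (state t w) (w t)) \<le> sqrt (real CARD('d))"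
    unfolding direction_def by (intro real_le_rsqrt norm_sign_vec_le)
  finally show ?case using step \<gamma>_pos by (simp add: algebra_simps)
qed

lemma distance_step:
  assumes "1 \<le> t"
  shows "(norm (fst (state (Suc t) w) - xstar))\<^sup>2
    \<le> (norm (fst (state t w) - xstar))\<^sup>2
      - 2 * \<gamma> * (direction (state t w) (w t) \<bullet> (fst (state t w) - xstar))
      + \<gamma>\<^sup>2 * real CARD('d)"
proof -
  let ?d = "direction (state t w) (w t)" and ?e = "fst (state t w) - xstar"
  have "fst (state (Suc t) w) - xstar = ?e - \<gamma> *\<^sub>R ?d"
    using assms by (simp add: state_Suc Let_def case_prod_beta)
  moreover have "(norm (e - c *\<^sub>R d))\<^sup>2 = (norm e)\<^sup>2 - 2 * c * (d \<bullet> e) + c\<^sup>2 * (norm d)\<^sup>2"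
    for e d :: "real ^ 'd" and c
    unfolding power2_norm_eq_inner
    by (simp add: inner_diff_left inner_diff_right inner_commute power2_eq_square algebra_simps)
  ultimately have "(norm (fst (state (Suc t) w) - xstar))\<^sup>2
      = (norm ?e)\<^sup>2 - 2 * \<gamma> * (?d \<bullet> ?e) + \<gamma>\<^sup>2 * (norm ?d)\<^sup>2"
    by (simp only:)
  moreover have "\<gamma>\<^sup>2 * (norm ?d)\<^sup>2 \<le> \<gamma>\<^sup>2 * real CARD('d)"
    unfolding direction_def by (intro mult_left_mono norm_sign_vec_le) auto
  ultimately show ?thesis by linarith
qed

end

subsection \<open>Independence and telescoping\<close>

text \<open>Independence within a round, given through preimages, is turned into a product law;
  agreement on measurable rectangles is enough.\<close>

lemma svrg_sampling_distr_pair: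
  assumes "svrg_sampling M n T I U" "t \<in> {1..T}"
  shows "distr M (count_space {1..n} \<Otimes>\<^sub>M borel) (\<lambda>\<omega>. (I t \<omega>, U t \<omega>))
    = uniform_count_measure {1..n} \<Otimes>\<^sub>M cube_measure"
proof -
  interpret prob_space M using assms(1) by (simp add: svrg_sampling_def)
  have I[measurable]: "I t \<in> M \<rightarrow>\<^sub>M count_space {1..n}"
    and dI: "distr M (count_space {1..n}) (I t) = uniform_count_measure {1..n}"
    and U[measurable]: "U t \<in> M \<rightarrow>\<^sub>M borel"
    and dU: "distr M borel (U t) = cube_measure"
    and ind: "indep_set {I t -` A \<inter> space M |A. A \<in> sets (count_space {1..n})}
                        {U t -` B \<inter> space M |B. B \<in> sets borel}"
    using assms unfolding svrg_sampling_def cube_eq_cbox by blast+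
  interpret A: prob_space "uniform_count_measure {1..n}"
    unfolding dI[symmetric] by (rule prob_space_distr) measurable
  interpret B: prob_space "cube_measure :: (real ^ 'b) measure" by (rule prob_space_cube)
  show ?thesis
  proof (rule pair_measure_eqI[symmetric])
    show "sets (uniform_count_measure {1..n} \<Otimes>\<^sub>M cube_measure)
        = sets (distr M (count_space {1..n} \<Otimes>\<^sub>M borel) (\<lambda>\<omega>. (I t \<omega>, U t \<omega>)))"
      unfolding sets_distr
      by (intro sets_pair_measure_cong) (simp_all add: sets_uniform_count_measure_count_space)
  next
    fix A B
    assume "A \<in> sets (uniform_count_measure {1..n})"
      and "B \<in> sets (cube_measure :: (real ^ 'b) measure)"
    then have A[measurable]: "A \<in> sets (count_space {1..n})" and B[measurable]: "B \<in> sets borel"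
      by (simp_all add: sets_uniform_count_measure_count_space)
    let ?a = "I t -` A \<inter> space M" and ?b = "U t -` B \<inter> space M"
    have "emeasure (uniform_count_measure {1..n}) A * emeasure cube_measure B
        = emeasure M ?a * emeasure M ?b"
      unfolding dI[symmetric] dU[symmetric]
      by (simp only: emeasure_distr[OF I A] emeasure_distr[OF U B])
    also have "\<dots> = ennreal (prob ?a * prob ?b)"
      by (simp add: emeasure_eq_measure ennreal_mult)
    also have "prob ?a * prob ?b = prob (?a \<inter> ?b)"
      using A B by (intro indep_setD[OF ind, symmetric]) blast+
    also have "?a \<inter> ?b = (\<lambda>\<omega>. (I t \<omega>, U t \<omega>)) -` (A \<times> B) \<inter> space M" by auto
    also have "ennreal (prob \<dots>)
        = emeasure (distr M (count_space {1..n} \<Otimes>\<^sub>M borel) (\<lambda>\<omega>. (I t \<omega>, U t \<omega>))) (A \<times> B)"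
      using A B by (subst emeasure_distr) (measurable, simp add: emeasure_eq_measure)
    finally show "emeasure (uniform_count_measure {1..n}) A * emeasure cube_measure B
        = emeasure (distr M (count_space {1..n} \<Otimes>\<^sub>M borel) (\<lambda>\<omega>. (I t \<omega>, U t \<omega>))) (A \<times> B)" .
  qed unfold_locales
qed

section \<open>Expectations along a randomly driven run\<close>

locale sampled_sign_svrg = sign_svrg_run p q n f L xstar D \<gamma> x1 + prob_space M
  for p q :: ennreal and n :: nat and f :: "nat \<Rightarrow> real ^ 'd \<Rightarrow> real" and L :: real
    and xstar :: "real ^ 'd" and D \<gamma> :: real and x1 :: "real ^ 'd" and M :: "'w measure" +
  fixes T :: nat and W :: "nat \<Rightarrow> 'w \<Rightarrow> nat \<times> (real ^ 'd)"
  assumes indep_W: "indep_vars (\<lambda>_. noise_space) W {1..T}"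
    and distr_W: "t \<in> {1..T} \<Longrightarrow> distr M noise_space (W t) = noise"
begin

abbreviation Z :: "nat \<Rightarrow> 'w \<Rightarrow> (real ^ 'd) \<times> (real ^ 'd)" where
  "Z t \<omega> \<equiv> state t (\<lambda>s. W s \<omega>)"

lemma W_measurable: "t \<in> {1..T} \<Longrightarrow> W t \<in> M \<rightarrow>\<^sub>M noise_space"
  using indep_W by (auto simp: indep_vars_def)

lemma Z_restrict: "1 \<le> t \<Longrightarrow> Z t \<omega> = state t (\<lambda>s\<in>{1..<t}. W s \<omega>)"
  by (rule state_cong) auto

lemma Z_measurable:
  assumes "t \<in> {1..Suc T}"
  shows "Z t \<in> M \<rightarrow>\<^sub>M borel \<Otimes>\<^sub>M borel"
proof -
  have "(\<lambda>\<omega>. \<lambda>s\<in>{1..<t}. W s \<omega>) \<in> M \<rightarrow>\<^sub>M PiM {1..<t} (\<lambda>_. noise_space)"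
    using assms by (intro measurable_restrict W_measurable) auto
  moreover have "state t \<in> PiM {1..<t} (\<lambda>_. noise_space) \<rightarrow>\<^sub>M borel \<Otimes>\<^sub>M borel"
    using assms by (intro state_measurable) auto
  ultimately have "(\<lambda>\<omega>. state t (\<lambda>s\<in>{1..<t}. W s \<omega>)) \<in> M \<rightarrow>\<^sub>M borel \<Otimes>\<^sub>M borel"
    by (rule measurable_compose)
  moreover have "Z t = (\<lambda>\<omega>. state t (\<lambda>s\<in>{1..<t}. W s \<omega>))"
    using assms by (intro ext Z_restrict) simp
  ultimately show ?thesis by (simp only:)
qed

text \<open>Since \<^const>\<open>indep_var\<close> relates variables of the same type only, independence of the state and
  the current noise is expressed as a factorisation of their joint distribution.\<close>

lemma distr_Z_W:
  assumes t: "t \<in> {1..T}"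
  shows "distr M (borel \<Otimes>\<^sub>M borel) (Z t) \<Otimes>\<^sub>M noise
    = distr M ((borel \<Otimes>\<^sub>M borel) \<Otimes>\<^sub>M noise_space) (\<lambda>\<omega>. (Z t \<omega>, W t \<omega>))"
proof -
  let ?S = "borel \<Otimes>\<^sub>M borel :: ((real ^ 'd) \<times> (real ^ 'd)) measure"
  let ?A = "PiM {1..<t} (\<lambda>_. noise_space)" and ?B = "PiM {t} (\<lambda>_. noise_space)"
  \<comment> \<open>The current sample is wrapped as a tuple over \<open>{t}\<close>, so that past
    and present have the same type; disjointness of the index sets gives their independence.\<close>
  let ?X = "\<lambda>\<omega>. \<lambda>s\<in>{1..<t}. W s \<omega>" and ?Y = "\<lambda>\<omega>. \<lambda>s\<in>{t}. W s \<omega>"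
  have "indep_var ?A ?X ?B ?Y"
    using t by (intro indep_var_restrict[OF indep_W]) auto
  then have X[measurable]: "?X \<in> M \<rightarrow>\<^sub>M ?A" and Y[measurable]: "?Y \<in> M \<rightarrow>\<^sub>M ?B"
    and joint: "distr M ?A ?X \<Otimes>\<^sub>M distr M ?B ?Y = distr M (?A \<Otimes>\<^sub>M ?B) (\<lambda>\<omega>. (?X \<omega>, ?Y \<omega>))"
    by (simp_all add: indep_var_distribution_eq)
  have st[measurable]: "state t \<in> ?A \<rightarrow>\<^sub>M ?S"
    using t by (intro state_measurable) auto
  have pr[measurable]: "(\<lambda>w. w t) \<in> ?B \<rightarrow>\<^sub>M noise_space"
    by (rule measurable_component_singleton) simp
  have Z_eq: "Z t = (\<lambda>\<omega>. state t (?X \<omega>))"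
    using t by (intro ext Z_restrict) simp
  have Z: "distr (distr M ?A ?X) ?S (state t) = distr M ?S (Z t)"
    unfolding Z_eq by (simp only: distr_distr[OF st X] comp_def)
  have W: "distr (distr M ?B ?Y) noise_space (\<lambda>w. w t) = noise"
    using distr_W[OF t] by (subst distr_distr[OF pr Y]) (simp add: comp_def)
  have "distr M ?S (Z t) \<Otimes>\<^sub>M noise
      = distr (distr M ?A ?X \<Otimes>\<^sub>M distr M ?B ?Y) (?S \<Otimes>\<^sub>M noise_space) (\<lambda>(x, y). (state t x, y t))"
    unfolding Z[symmetric] W[symmetric]
  proof (rule pair_measure_distr)
    show "sigma_finite_measure (distr (distr M ?B ?Y) noise_space (\<lambda>w. w t))"
      unfolding W using prob_space_noise by (rule prob_space_imp_sigma_finite)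
  qed measurable
  also have "\<dots> = distr M (?S \<Otimes>\<^sub>M noise_space) (\<lambda>\<omega>. (state t (?X \<omega>), W t \<omega>))"
    unfolding joint
  proof (subst distr_distr)
    show "(\<lambda>(x, y). (state t x, y t)) \<in> ?A \<Otimes>\<^sub>M ?B \<rightarrow>\<^sub>M ?S \<Otimes>\<^sub>M noise_space"
      and "(\<lambda>\<omega>. (?X \<omega>, ?Y \<omega>)) \<in> M \<rightarrow>\<^sub>M ?A \<Otimes>\<^sub>M ?B" by measurable
  qed (simp add: comp_def)
  also have "\<dots> = distr M (?S \<Otimes>\<^sub>M noise_space) (\<lambda>\<omega>. (Z t \<omega>, W t \<omega>))"
    using t by (subst Z_restrict) auto
  finally show ?thesis .
qed

text \<open>A continuous function is bounded on the compact ball that contains the iterate. The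
  range includes \<open>Suc T\<close>, the index of the last distance in the telescoping
  sum.\<close>

lemma integrable_continuous_iterate:
  fixes h :: "real ^ 'd \<Rightarrow> real"
  assumes "continuous_on UNIV h" "t \<in> {1..Suc T}"
  shows "integrable M (\<lambda>\<omega>. h (fst (Z t \<omega>)))"
proof -
  note [measurable] = Z_measurable[OF assms(2)]
  have [measurable]: "h \<in> borel_measurable borel"
    using assms(1) by (rule borel_measurable_continuous_onI)
  define R where "R = norm x1 + real t * (\<gamma> * sqrt (real CARD('d)))"
  have "compact (h ` cball 0 R)"
    using assms(1) by (intro compact_continuous_image) (auto intro: continuous_on_subset)
  then obtain B where B: "\<And>v. v \<in> cball 0 R \<Longrightarrow> norm (h v) \<le> B"
    using compact_imp_bounded bounded_iff by (metis imageI)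
  have "norm (h (fst (Z t \<omega>))) \<le> B" for \<omega>
    using state_bounded[of t "\<lambda>s. W s \<omega>"] assms(2) by (intro B) (simp add: R_def)
  then show ?thesis
    by (intro integrable_const_bound[where B = B] AE_I2) measurable
qed

text \<open>Under the product law of state and noise, the inner integral over the noise plays the
  part of the conditional expectation given the past, and the bound for fixed vectors applies to
  it.\<close>

lemma expected_gap_ratio_le:
  assumes t: "t \<in> {1..T}"
  shows "expectation (\<lambda>\<omega>. gap_ratio D (fst (Z t \<omega>)))
    \<le> expectation (\<lambda>\<omega>. direction (Z t \<omega>) (W t \<omega>) \<bullet> (fst (Z t \<omega>) - xstar))"
    and "integrable M (\<lambda>\<omega>. direction (Z t \<omega>) (W t \<omega>) \<bullet> (fst (Z t \<omega>) - xstar))"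
proof -
  have t': "t \<in> {1..Suc T}" using t by simp
  note [measurable] = Z_measurable[OF t'] W_measurable[OF t]
  let ?S = "borel \<Otimes>\<^sub>M borel :: ((real ^ 'd) \<times> (real ^ 'd)) measure"
  let ?Z = "distr M ?S (Z t)"
  define h where "h = (\<lambda>(z, w). direction z w \<bullet> (fst z - xstar))"
  have h[measurable]: "h \<in> borel_measurable (?S \<Otimes>\<^sub>M noise_space)"
  proof -
    have "(\<lambda>zw. (case_prod direction) zw \<bullet> (fst (fst zw) - xstar))
        \<in> borel_measurable (?S \<Otimes>\<^sub>M noise_space)" by measurable
    then show ?thesis by (simp add: h_def case_prod_beta')
  qed
  have joint: "?Z \<Otimes>\<^sub>M noise = distr M (?S \<Otimes>\<^sub>M noise_space) (\<lambda>\<omega>. (Z t \<omega>, W t \<omega>))"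
    by (rule distr_Z_W[OF t])
  have ZW[measurable]: "(\<lambda>\<omega>. (Z t \<omega>, W t \<omega>)) \<in> M \<rightarrow>\<^sub>M ?S \<Otimes>\<^sub>M noise_space"
    by measurable
  have int: "integrable M (\<lambda>\<omega>. h (Z t \<omega>, W t \<omega>))"
  proof (rule Bochner_Integration.integrable_bound)
    show "integrable M (\<lambda>\<omega>. sqrt (real CARD('d)) * norm (fst (Z t \<omega>) - xstar))"
      by (rule integrable_continuous_iterate[OF _ t']) (intro continuous_intros)
    have "\<bar>h (z, w)\<bar> \<le> sqrt (real CARD('d)) * norm (fst z - xstar)" for z w
    proof -
      have "\<bar>h (z, w)\<bar> \<le> norm (direction z w) * norm (fst z - xstar)"
        unfolding h_def by (simp add: Cauchy_Schwarz_ineq2)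
      also have "norm (direction z w) \<le> sqrt (real CARD('d))"
        unfolding direction_def by (intro real_le_rsqrt norm_sign_vec_le)
      finally show ?thesis by (simp add: mult_right_mono)
    qed
    then show "AE \<omega> in M. norm (h (Z t \<omega>, W t \<omega>))
        \<le> norm (sqrt (real CARD('d)) * norm (fst (Z t \<omega>) - xstar))"
      by (intro AE_I2) (simp add: abs_mult)
  qed measurable
  then show "integrable M (\<lambda>\<omega>. direction (Z t \<omega>) (W t \<omega>) \<bullet> (fst (Z t \<omega>) - xstar))"
    by (simp add: h_def)
  interpret N: prob_space noise by (rule prob_space_noise)
  interpret Zs: prob_space ?Z by (rule prob_space_distr) measurable
  interpret ZN: pair_prob_space ?Z noise ..
  have int_joint: "integrable (?Z \<Otimes>\<^sub>M noise) h"
    unfolding joint using int by (subst integrable_distr_eq[OF ZW h])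
  have gap[measurable]: "gap_ratio D \<in> borel_measurable borel"
    by (intro borel_measurable_continuous_onI continuous_gap_ratio D_pos)
  have "expectation (\<lambda>\<omega>. gap_ratio D (fst (Z t \<omega>))) = (\<integral>z. gap_ratio D (fst z) \<partial>?Z)"
    by (rule integral_distr[symmetric]) measurable
  also have "\<dots> \<le> (\<integral>z. (\<integral>w. h (z, w) \<partial>noise) \<partial>?Z)"
  proof (rule integral_mono_AE)
    show "integrable ?Z (\<lambda>z. gap_ratio D (fst z))"
      using integrable_continuous_iterate[OF continuous_gap_ratio[OF D_pos] t']
      by (subst integrable_distr_eq) auto
    show "integrable ?Z (\<lambda>z. \<integral>w. h (z, w) \<partial>noise)"
      using int_joint by (rule ZN.integrable_fst')
    have [measurable]: "Measurable.pred ?S (\<lambda>z. lnorm q (fst z - snd z) \<le> D)"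
      by measurable
    \<comment> \<open>Closeness to the reference point holds for reachable states, hence almost
      everywhere under their law.\<close>
    have "AE z in ?Z. lnorm q (fst z - snd z) \<le> D"
      using t by (subst AE_distr_iff) (auto intro!: state_near_reference)
    then show "AE z in ?Z. gap_ratio D (fst z) \<le> (\<integral>w. h (z, w) \<partial>noise)"
    proof eventually_elim
      fix z :: "(real ^ 'd) \<times> (real ^ 'd)" assume "lnorm q (fst z - snd z) \<le> D"
      from gap_ratio_le[OF D_pos this]
      show "gap_ratio D (fst z) \<le> (\<integral>w. h (z, w) \<partial>noise)" by (simp add: h_def)
    qed
  qed
  also have "\<dots> = integral\<^sup>L (?Z \<Otimes>\<^sub>M noise) h"
    using int_joint by (rule ZN.integral_fst')
  also have "\<dots> = expectation (\<lambda>\<omega>. h (Z t \<omega>, W t \<omega>))"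
    unfolding joint by (rule integral_distr) measurable
  finally show "expectation (\<lambda>\<omega>. gap_ratio D (fst (Z t \<omega>)))
      \<le> expectation (\<lambda>\<omega>. direction (Z t \<omega>) (W t \<omega>) \<bullet> (fst (Z t \<omega>) - xstar))"
    by (simp add: h_def)
qed

lemma expected_distance_step:
  assumes t: "t \<in> {1..T}"
  shows "2 * \<gamma> * expectation (\<lambda>\<omega>. gap_ratio D (fst (Z t \<omega>)))
    \<le> expectation (\<lambda>\<omega>. (norm (fst (Z t \<omega>) - xstar))\<^sup>2)
      - expectation (\<lambda>\<omega>. (norm (fst (Z (Suc t) \<omega>) - xstar))\<^sup>2) + \<gamma>\<^sup>2 * real CARD('d)"
proof -
  let ?e = "\<lambda>t \<omega>. (norm (fst (Z t \<omega>) - xstar))\<^sup>2"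
  let ?i = "\<lambda>\<omega>. direction (Z t \<omega>) (W t \<omega>) \<bullet> (fst (Z t \<omega>) - xstar)"
  have int: "integrable M (?e s)" if "s \<in> {1..Suc T}" for s
    using that by (intro integrable_continuous_iterate) (auto intro!: continuous_intros)
  note int_i = expected_gap_ratio_le(2)[OF t]
  have "expectation (?e (Suc t))
      \<le> expectation (\<lambda>\<omega>. ?e t \<omega> - 2 * \<gamma> * ?i \<omega> + \<gamma>\<^sup>2 * real CARD('d))"
    using t int_i int by (intro integral_mono distance_step) auto
  also have "\<dots> = expectation (?e t) - 2 * \<gamma> * expectation ?i + \<gamma>\<^sup>2 * real CARD('d)"
    using t int_i int[of t] by (simp add: prob_space)
  also have "\<dots> \<le> expectation (?e t) - 2 * \<gamma> * expectation (\<lambda>\<omega>. gap_ratio D (fst (Z t \<omega>)))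
      + \<gamma>\<^sup>2 * real CARD('d)"
    using expected_gap_ratio_le(1)[OF t] \<gamma>_pos by simp
  finally show ?thesis by simp
qed

lemma average_gap_ratio_le:
  assumes "1 \<le> T"
  shows "(1 / real T) * (\<Sum>t = 1..T. expectation (\<lambda>\<omega>. gap_ratio D (fst (Z t \<omega>))))
    \<le> (norm (x1 - xstar))\<^sup>2 / (2 * real T * \<gamma>) + \<gamma> * real CARD('d) / 2"
proof -
  define V where "V t = expectation (\<lambda>\<omega>. (norm (fst (Z t \<omega>) - xstar))\<^sup>2)" for t
  let ?S = "\<Sum>t = 1..T. expectation (\<lambda>\<omega>. gap_ratio D (fst (Z t \<omega>)))"
  have "2 * \<gamma> * ?S \<le> (\<Sum>t = 1..T. V t - V (Suc t) + \<gamma>\<^sup>2 * real CARD('d))"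
    unfolding sum_distrib_left V_def by (intro sum_mono expected_distance_step)
  also have "\<dots> = V 1 - V (Suc T) + real T * (\<gamma>\<^sup>2 * real CARD('d))"
    using assms sum_Suc_diff[of 1 T "\<lambda>t. - V t"] by (simp add: sum.distrib)
  \<comment> \<open>\<open>V 1\<close> is the expectation of a constant, as the start is
    deterministic, and the nonnegative \<open>V (Suc T)\<close> is dropped.\<close>
  also have "\<dots> \<le> (norm (x1 - xstar))\<^sup>2 + real T * (\<gamma>\<^sup>2 * real CARD('d))"
    by (simp add: V_def state_init prob_space)
  finally have "?S \<le> ((norm (x1 - xstar))\<^sup>2 + real T * (\<gamma>\<^sup>2 * real CARD('d))) / (2 * \<gamma>)"
    using \<gamma>_pos by (simp add: field_simps)
  then have "(1 / real T) * ?S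
      \<le> (1 / real T) * (((norm (x1 - xstar))\<^sup>2 + real T * (\<gamma>\<^sup>2 * real CARD('d))) / (2 * \<gamma>))"
    by (intro mult_left_mono) auto
  also have "\<dots> = (norm (x1 - xstar))\<^sup>2 / (2 * real T * \<gamma>) + \<gamma> * real CARD('d) / 2"
    using assms \<gamma>_pos by (simp add: field_simps power2_eq_square)
  finally show ?thesis .
qed

end

theorem theorem3:
  fixes n T :: nat
    and p q :: ennreal
    and f :: "nat \<Rightarrow> real ^ 'd \<Rightarrow> real"
    and F :: "real ^ 'd \<Rightarrow> real"
    and L D \<gamma> fstar :: real
    and xstar x1 :: "real ^ 'd"
    and M :: "'w measure"
    and I :: "nat \<Rightarrow> 'w \<Rightarrow> nat"
    and U :: "nat \<Rightarrow> 'w \<Rightarrow> real ^ 'd"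
    and x :: "nat \<Rightarrow> 'w \<Rightarrow> real ^ 'd"
  defines "F \<equiv> average n f"
    and "fstar \<equiv> F xstar"
    and "x \<equiv> \<lambda>t \<omega>. iterate (sign_svrg n f p q L D \<gamma> x1 (\<lambda>s. I s \<omega>) (\<lambda>s. U s \<omega>) t)"
  assumes "n \<ge> 1" and "T \<ge> 1"
    and "p \<ge> 1" and "q \<ge> 1" and "1 / p + 1 / q = 1"
    and "\<And>i. i \<in> {1..n} \<Longrightarrow> continuously_differentiable (f i)"
    and "L > 0"
    and "\<And>i y z. i \<in> {1..n} \<Longrightarrow> lnorm p (grad (f i) y - grad (f i) z) \<le> L * lnorm q (y - z)"
    and "convex_on UNIV F"
    and "\<And>y. F xstar \<le> F y"
    and "D > 0" and "\<gamma> > 0"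
    and "svrg_sampling M n T I U"
  shows "(\<forall>t\<in>{1..T}. integrable M (\<lambda>\<omega>.
            (F (x t \<omega>) - fstar) / (2 * L * D + sqrt (2 * L * (F (x t \<omega>) - fstar)))))
       \<and> (1 / real T) * (\<Sum>t = 1..T. prob_space.expectation M (\<lambda>\<omega>.
            (F (x t \<omega>) - fstar) / (2 * L * D + sqrt (2 * L * (F (x t \<omega>) - fstar)))))
         \<le> (norm (x1 - xstar))\<^sup>2 / (2 * real T * \<gamma>) + \<gamma> * real CARD('d) / 2"
proof -
  have sampling: "prob_space M"
      "prob_space.indep_vars M (\<lambda>_. count_space {1..n} \<Otimes>\<^sub>M borel) (\<lambda>t \<omega>. (I t \<omega>, U t \<omega>)) {1..T}"
    using assms(16) by (simp_all add: svrg_sampling_def)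
  interpret smooth_convex_finite_sum p q n f L xstar
    using assms(4,6-13) by unfold_locales (auto simp: F_def)
  interpret prob_space M by (rule sampling)
  interpret sampled_sign_svrg p q n f L xstar D \<gamma> x1 M T "\<lambda>t \<omega>. (I t \<omega>, U t \<omega>)"
    using assms(14-15) sampling(2) svrg_sampling_distr_pair[OF assms(16)]
    by unfold_locales (simp_all add: noise_def)
  have x: "x t \<omega> = fst (Z t \<omega>)" for t \<omega>
    by (simp add: x_def state_def run_def)
  have gap: "(F y - fstar) / (2 * L * D + sqrt (2 * L * (F y - fstar))) = gap_ratio D y" for y
    by (simp add: gap_ratio_def F_def fstar_def)
  \<comment> \<open>Integrability accompanies the inequality because the integral of a
    non-integrable function is 0 by default.\<close>
  show ?thesis
    unfolding x gap
    using average_gap_ratio_le[OF assms(5)]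
      integrable_continuous_iterate[OF continuous_gap_ratio[OF D_pos]] by auto
qed

end
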